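(* Let $V_1,V_2\in C^\infty(\mathbb{R},\mathbb{R})$, $m\in\mathbb{R}$, and $K_i(z_i,w_i)=\frac{w_i^2}{2}+V_i(z_i^2)$ for $i=1,2$. Let $J\subset\mathbb{R}$ be an open interval such that for every $a\in J$, with $b=m-a$, the level sets $\{K_1=a\}$ and $\{K_2=b\}$ are closed simple curves in $\mathbb{R}^2$ enclosing domains that are star-shaped with respect to the origin, in the sense that every ray from the origin meets the curve in exactly one point (different from the origin). Let $I_1(a)$ and $I_2(b)$ be the corresponding action variables, and regard $I_2$ as a function of $I_1$ through the relation $a+b=m$. Then: (i) $I_2$ is a convex function of $I_1$ if $$V_1'(z_1^2)>0,\quad V_1''(z_1^2)<0,\quad V_2'(z_2^2)>0,\quad V_2''(z_2^2)<0;$$ (ii) $I_2$ is a concave function of $I_1$ if $$V_1'(z_1^2)>0,\quad V_1''(z_1^2)>0,\quad V_2'(z_2^2)>0,\quad V_2''(z_2^2)>0;$$ where the inequalities are required at all points $(z_1,w_1)$ of the curves $\{K_1=a\}$ and all points $(z_2,w_2)$ of the curves $\{K_2=m-a\}$, $a\in J$.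
   Context: The notation $V_i'(z_i^2)$, $V_i''(z_i^2)$ means the first and second derivatives of the one-variable function $V_i$, evaluated at $z_i^2$. The action variables are $I_1(a)=\frac{1}{2\pi}\int_{\{K_1=a\}}w_1\,dz_1$ and $I_2(b)=\frac{1}{2\pi}\int_{\{K_2=b\}}w_2\,dz_2$, i.e. $\frac{1}{2\pi}$ times the areas enclosed by the closed curves $\{K_1=a\}$ and $\{K_2=b\}$; they are strictly increasing in $a\in J$ and $b\in m-J$ respectively. That $I_2$ is regarded as a function of $I_1$ means: the function $\varphi:I_1(J)\to\mathbb{R}$ with $\varphi(I_1(a))=I_2(m-a)$ for all $a\in J$. *)

theory Defs
  imports "HOL-Analysis.Analysis"
begin

definition smooth_fun :: "(real \<Rightarrow> real) \<Rightarrow> bool" where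
  "smooth_fun f \<longleftrightarrow> (\<forall>n. (deriv ^^ n) f differentiable_on UNIV)"

definition K :: "(real \<Rightarrow> real) \<Rightarrow> real \<times> real \<Rightarrow> real" where
  "K V = (\<lambda>(z, w). w\<^sup>2 / 2 + V (z\<^sup>2))"

definition level_set :: "(real \<Rightarrow> real) \<Rightarrow> real \<Rightarrow> (real \<times> real) set" where
  "level_set V a = {p. K V p = a}"

definition closed_simple_curve :: "(real \<times> real) set \<Rightarrow> bool" where
  "closed_simple_curve C \<longleftrightarrow>
     (\<exists>\<gamma>. simple_path \<gamma> \<and> pathfinish \<gamma> = pathstart \<gamma> \<and> path_image \<gamma> = C)"

definition ray :: "real \<times> real \<Rightarrow> (real \<times> real) set" where
  "ray v = {t *\<^sub>R v | t. 0 \<le> t}"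

definition star_shaped_curve :: "(real \<times> real) set \<Rightarrow> bool" where
  "star_shaped_curve C \<longleftrightarrow> (\<forall>v. v \<noteq> 0 \<longrightarrow> (\<exists>p. p \<noteq> 0 \<and> ray v \<inter> C = {p}))"

(* The loop integral of w dz over a level curve, oriented by the Hamiltonian flow
   (clockwise), is the area of the domain enclosed by the curve; this area is taken
   as the meaning of the integral, so no parametrization has to be chosen. *)
definition action :: "(real \<Rightarrow> real) \<Rightarrow> real \<Rightarrow> real" where
  "action V a = measure lborel (inside (level_set V a)) / (2 * pi)"

end

theory Submission
  imports Defs
begin

text \<open>
  Substituting \<open>w = \<tau> z\<close> turns \<open>K V (z, w) = a\<close> into \<open>s \<tau>\<^sup>2 / 2 + V s = a\<close> with
  \<open>s = z\<^sup>2\<close>. The left-hand side is a function of \<open>s\<close> whose second derivative is \<open>V'' s\<close> and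
  which, because \<open>V' > 0\<close> on the curve, increases where it takes values in the interval of
  energies. Star-shapedness makes its nonnegative root \<open>s(\<tau>, a)\<close> unique. Inverting an
  increasing concave function gives a convex one, so \<open>V'' < 0\<close> makes \<open>s(\<tau>, a)\<close> convex in
  \<open>a\<close>; likewise \<open>V'' > 0\<close> makes it concave (lemmas \<open>root_convex\<close> and \<open>root_concave\<close>).

  The Jacobian of \<open>(z, \<tau>) \<mapsto> (z, \<tau> z)\<close> is \<open>\<bar>z\<bar>\<close>, and \<open>\<bar>z\<bar>\<close> integrates to \<open>s\<close> over
  \<open>{z. z\<^sup>2 < s}\<close>. Hence the enclosed area is \<open>\<integral> s(\<tau>, a) d\<tau>\<close> (lemma \<open>emeasure_sublevel\<close>),
  and each action inherits convexity or concavity in the energy by integrating a pointwise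
  inequality; the actions need not be differentiated.

  Finally \<open>\<phi> = I\<^sub>2 \<circ> (\<lambda>a. m - a) \<circ> I\<^sub>1\<^sup>-\<^sup>1\<close>. If \<open>I\<^sub>1\<close> is increasing and convex, its inverse is
  concave, so \<open>m - I\<^sub>1\<^sup>-\<^sup>1\<close> is convex, and composing with the increasing convex \<open>I\<^sub>2\<close> preserves
  convexity; concavity is dual.
\<close>

section \<open>Roots of a function that increases at each root\<close>

definition nonneg_root :: "(real \<Rightarrow> real) \<Rightarrow> real \<Rightarrow> real" where
  "nonneg_root h a = (THE s. 0 \<le> s \<and> h s = a)"

locale increasing_levels =
  fixes h h' :: "real \<Rightarrow> real" and J :: "real set"
  assumes interval: "is_interval J"
    and deriv: "\<And>s. (h has_real_derivative h' s) (at s)"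
    and unique: "\<And>a. a \<in> J \<Longrightarrow> \<exists>!s. 0 \<le> s \<and> h s = a"
    and increasing: "\<And>s. 0 \<le> s \<Longrightarrow> h s \<in> J \<Longrightarrow> h' s > 0"
begin

lemma continuous: "continuous_on A h"
  using deriv by (meson DERIV_continuous_on DERIV_subset subset_UNIV)

lemma root:
  assumes "a \<in> J"
  shows root_nonneg: "0 \<le> nonneg_root h a" and h_root: "h (nonneg_root h a) = a"
  using theI'[OF unique[OF assms]] unfolding nonneg_root_def by auto

lemma root_unique:
  assumes "a \<in> J" "0 \<le> s" "h s = a"
  shows "s = nonneg_root h a"
  using unique[OF assms(1)] assms root by blast

text \<open>Just to the right of the root the function exceeds \<open>a\<close>, since the derivative there is
  positive; returning to \<open>a\<close> later would produce a second root. The left side is symmetric.\<close>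

lemma above_root:
  assumes a: "a \<in> J" and s: "nonneg_root h a < s"
  shows "a < h s"
proof (rule ccontr)
  assume n: "\<not> a < h s"
  let ?r = "nonneg_root h a"
  have "h' ?r > 0"
    using increasing root[OF a] a by auto
  then obtain d where d: "d > 0" "\<And>e. 0 < e \<Longrightarrow> e < d \<Longrightarrow> h ?r < h (?r + e)"
    using DERIV_pos_inc_right[OF deriv] by blast
  define e where "e = min (d / 2) ((s - ?r) / 2)"
  have e: "0 < e" "e < d" "?r + e < s"
    using d s by (auto simp: e_def min_def field_simps)
  have "a \<le> h (?r + e)"
    using d(2)[OF e(1,2)] h_root[OF a] by simp
  then obtain x where "?r + e \<le> x" "h x = a"
    using IVT2'[of h s a "?r + e"] n e continuous by auto
  then show False
    using root_unique[OF a, of x] e root_nonneg[OF a] by auto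
qed

lemma below_root:
  assumes a: "a \<in> J" and s: "0 \<le> s" "s < nonneg_root h a"
  shows "h s < a"
proof (rule ccontr)
  assume n: "\<not> h s < a"
  let ?r = "nonneg_root h a"
  have "h' ?r > 0"
    using increasing root[OF a] a by auto
  then obtain d where d: "d > 0" "\<And>e. 0 < e \<Longrightarrow> e < d \<Longrightarrow> h (?r - e) < h ?r"
    using DERIV_pos_inc_left[OF deriv] by blast
  define e where "e = min (d / 2) ((?r - s) / 2)"
  have e: "0 < e" "e < d" "s < ?r - e"
    using d s by (auto simp: e_def min_def field_simps)
  have "h (?r - e) \<le> a"
    using d(2)[OF e(1,2)] h_root[OF a] by simp
  then obtain x where "s \<le> x" "x \<le> ?r - e" "h x = a"
    using IVT2'[of h "?r - e" a s] n e continuous by auto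
  then show False
    using root_unique[OF a, of x] e s by auto
qed

lemma less_iff:
  assumes a: "a \<in> J" and "0 \<le> s"
  shows "h s < a \<longleftrightarrow> s < nonneg_root h a"
  using above_root[OF a, of s] below_root[OF a, of s] h_root[OF a] assms
  by (metis linorder_neqE_linordered_idom order_less_irrefl order_less_asym)

text \<open>Between two points of the preimage, \<open>h\<close> is squeezed between its end values and so cannot
  leave the interval \<open>J\<close>. This makes the second derivative test available on the preimage.\<close>

lemma convex_preimage: "convex {s. 0 \<le> s \<and> h s \<in> J}"
proof -
  have "h u \<in> J"
    if xy: "0 \<le> x" "h x \<in> J" "h y \<in> J" and u: "x \<le> u" "u \<le> y" for x y u
  proof -
    have "x = nonneg_root h (h x)" "y = nonneg_root h (h y)"
      using root_unique xy u by auto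
    then have "h x \<le> h u" "h u \<le> h y"
      using above_root[OF xy(2), of u] below_root[OF xy(3), of u] xy u
      by (metis order.order_iff_strict order.trans)+
    with interval xy show "h u \<in> J"
      unfolding is_interval_1 by blast
  qed
  then have "is_interval {s. 0 \<le> s \<and> h s \<in> J}"
    unfolding is_interval_1 by (metis (mono_tags, lifting) mem_Collect_eq order.trans)
  then show ?thesis
    by (simp add: is_interval_convex_1)
qed

text \<open>Concavity puts the value of \<open>h\<close> at the average of two roots above the average level, so the
  root of the average level lies to the left of the average root.\<close>

lemma root_convex:
  assumes deriv2: "\<And>s. (h' has_real_derivative h'' s) (at s)"
    and neg: "\<And>s. 0 \<le> s \<Longrightarrow> h s \<in> J \<Longrightarrow> h'' s \<le> 0"
  shows "convex_on J (nonneg_root h)"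
  unfolding convex_on_def
proof (intro conjI ballI allI impI)
  show J: "convex J"
    using interval by (simp add: is_interval_convex_1)
  have "concave_on {s. 0 \<le> s \<and> h s \<in> J} h"
    by (rule f''_le0_imp_concave[OF convex_preimage deriv deriv2]) (use neg in auto)
  note conc = this[unfolded concave_on_iff, THEN conjunct2, rule_format]
  fix a b u v :: real
  assume ab: "a \<in> J" "b \<in> J" and uv: "0 \<le> u" "0 \<le> v" "u + v = 1"
  let ?r = "nonneg_root h"
  have c: "u *\<^sub>R a + v *\<^sub>R b \<in> J"
    using J ab uv by (simp add: convex_def)
  have "u * h (?r a) + v * h (?r b) \<le> h (u *\<^sub>R ?r a + v *\<^sub>R ?r b)"
    using ab uv root by (intro conc) auto
  then have "\<not> h (u * ?r a + v * ?r b) < u *\<^sub>R a + v *\<^sub>R b"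
    using h_root ab by simp
  moreover have "0 \<le> u * ?r a + v * ?r b"
    using uv ab root_nonneg by simp
  ultimately show "?r (u *\<^sub>R a + v *\<^sub>R b) \<le> u * ?r a + v * ?r b"
    using less_iff[OF c, of "u * ?r a + v * ?r b"] by (meson not_le)
qed

lemma root_concave:
  assumes deriv2: "\<And>s. (h' has_real_derivative h'' s) (at s)"
    and pos: "\<And>s. 0 \<le> s \<Longrightarrow> h s \<in> J \<Longrightarrow> h'' s \<ge> 0"
  shows "concave_on J (nonneg_root h)"
  unfolding concave_on_iff
proof (intro conjI ballI allI impI)
  show J: "convex J"
    using interval by (simp add: is_interval_convex_1)
  have "convex_on {s. 0 \<le> s \<and> h s \<in> J} h"
    by (rule f''_ge0_imp_convex[OF convex_preimage deriv deriv2]) (use pos in auto)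
  note conv = this[unfolded convex_on_def, THEN conjunct2, rule_format]
  fix a b u v :: real
  assume ab: "a \<in> J" "b \<in> J" and uv: "0 \<le> u" "0 \<le> v" "u + v = 1"
  let ?r = "nonneg_root h"
  have c: "u *\<^sub>R a + v *\<^sub>R b \<in> J"
    using J ab uv by (simp add: convex_def)
  have "h (u *\<^sub>R ?r a + v *\<^sub>R ?r b) \<le> u * h (?r a) + v * h (?r b)"
    using ab uv root by (intro conv) auto
  then have "\<not> u *\<^sub>R a + v *\<^sub>R b < h (u * ?r a + v * ?r b)"
    using h_root ab by simp
  then show "u * ?r a + v * ?r b \<le> ?r (u *\<^sub>R a + v *\<^sub>R b)"
    using above_root[OF c, of "u * ?r a + v * ?r b"] by (meson not_le)
qed

end

section \<open>Area in the coordinates \<open>(z, w / z)\<close>\<close>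

lemma nn_integral_abs_square_less:
  fixes s :: real
  assumes "0 \<le> s"
  shows "(\<integral>\<^sup>+x. ennreal \<bar>x\<bar> * indicator {x. x\<^sup>2 < s} x \<partial>lborel) = ennreal s"
proof -
  define r where "r = sqrt s"
  have r: "0 \<le> r" "r\<^sup>2 = s"
    using assms by (auto simp: r_def)
  have iff: "x\<^sup>2 < s \<longleftrightarrow> - r < x \<and> x < r" for x
    using real_sqrt_less_iff[of "x\<^sup>2" s] by (auto simp: r_def)
  have "(\<integral>\<^sup>+x. ennreal \<bar>x\<bar> * indicator {x. x\<^sup>2 < s} x \<partial>lborel)
      = (\<integral>\<^sup>+x. ennreal (- x) * indicator {-r..0} x + ennreal x * indicator {0..r} x \<partial>lborel)"
  proof (rule nn_integral_cong_AE)
    show "AE x in lborel. ennreal \<bar>x\<bar> * indicator {x. x\<^sup>2 < s} x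
        = ennreal (- x) * indicator {-r..0} x + ennreal x * indicator {0..r} x"
      using AE_lborel_singleton[of "-r"] AE_lborel_singleton[of r]
      by eventually_elim (auto simp: indicator_def iff abs_if ennreal_neg)
  qed
  also have "\<dots> = (\<integral>\<^sup>+x. ennreal (- x) * indicator {-r..0} x \<partial>lborel)
      + (\<integral>\<^sup>+x. ennreal x * indicator {0..r} x \<partial>lborel)"
    by (rule nn_integral_add) auto
  also have "(\<integral>\<^sup>+x. ennreal (- x) * indicator {-r..0} x \<partial>lborel) = ennreal (- 0\<^sup>2 / 2 - - (- r)\<^sup>2 / 2)"
    using r by (intro nn_integral_FTC_Icc) (auto intro!: derivative_eq_intros)
  also have "(\<integral>\<^sup>+x. ennreal x * indicator {0..r} x \<partial>lborel) = ennreal (r\<^sup>2 / 2 - 0\<^sup>2 / 2)"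
    using r by (intro nn_integral_FTC_Icc) (auto intro!: derivative_eq_intros)
  also have "ennreal (- 0\<^sup>2 / 2 - - (- r)\<^sup>2 / 2) + ennreal (r\<^sup>2 / 2 - 0\<^sup>2 / 2) = ennreal s"
    using r assms by (simp flip: ennreal_plus)
  finally show ?thesis .
qed

text \<open>For fixed \<open>x\<close> the change of variable \<open>w = \<tau> * x\<close> is a scaling of the line, valid off the
  null set \<open>x = 0\<close>; exchanging the order of integration then puts the slope outermost. Unlike polar
  coordinates this uses only one-dimensional linear substitutions.\<close>

lemma emeasure_slope_coordinates:
  fixes D :: "(real \<times> real) set"
  assumes [measurable]: "D \<in> sets borel"
  shows "emeasure lborel D = (\<integral>\<^sup>+\<tau>. \<integral>\<^sup>+x. ennreal \<bar>x\<bar> * indicator D (x, \<tau> * x) \<partial>lborel \<partial>lborel)"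
proof -
  have [measurable]: "D \<in> sets (borel \<Otimes>\<^sub>M borel)"
    using assms by (subst borel_prod)
  have "emeasure lborel D = emeasure (lborel \<Otimes>\<^sub>M lborel) D"
    by (simp add: lborel_prod)
  also have "\<dots> = (\<integral>\<^sup>+x. \<integral>\<^sup>+w. indicator D (x, w) \<partial>lborel \<partial>lborel)"
    by (rule lborel.emeasure_pair_measure) measurable
  also have "\<dots> = (\<integral>\<^sup>+x. \<integral>\<^sup>+\<tau>. ennreal \<bar>x\<bar> * indicator D (x, \<tau> * x) \<partial>lborel \<partial>lborel)"
  proof (rule nn_integral_cong_AE)
    show "AE x in lborel. (\<integral>\<^sup>+w. indicator D (x, w) \<partial>lborel)
        = (\<integral>\<^sup>+\<tau>. ennreal \<bar>x\<bar> * indicator D (x, \<tau> * x) \<partial>lborel)"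
      using AE_lborel_singleton[of 0]
    proof eventually_elim
      case (elim x)
      have "(\<integral>\<^sup>+w. indicator D (x, w) \<partial>lborel)
          = ennreal \<bar>x\<bar> * (\<integral>\<^sup>+\<tau>. indicator D (x, 0 + x * \<tau>) \<partial>lborel)"
        using elim by (intro nn_integral_real_affine) measurable
      then show ?case
        by (subst nn_integral_cmult) (simp_all add: mult.commute)
    qed
  qed
  also have "\<dots> = (\<integral>\<^sup>+\<tau>. \<integral>\<^sup>+x. ennreal \<bar>x\<bar> * indicator D (x, \<tau> * x) \<partial>lborel \<partial>lborel)"
    by (rule lborel_pair.Fubini'[symmetric]) measurable
  finally show ?thesis .
qed

section \<open>The enclosed region and its action\<close>

text \<open>Writing points of the ray through \<open>p\<close> as \<open>sqrt s *\<^sub>R p\<close> makes the energy a function of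
  \<open>s\<close> in which \<open>V\<close> is evaluated at an affine argument, so that its convexity survives.\<close>

definition ray_energy :: "(real \<Rightarrow> real) \<Rightarrow> real \<times> real \<Rightarrow> real \<Rightarrow> real" where
  "ray_energy V p s = s * (snd p)\<^sup>2 / 2 + V (s * (fst p)\<^sup>2)"

lemma K_scaleR: "K V (t *\<^sub>R p) = ray_energy V p (t\<^sup>2)"
  by (cases p) (simp add: K_def ray_energy_def power_mult_distrib)

lemma K_sqrt_scaleR: "0 \<le> s \<Longrightarrow> K V (sqrt s *\<^sub>R p) = ray_energy V p s"
  by (simp add: K_scaleR)

lemma K_eq_ray_energy: "K V p = ray_energy V p 1"
  using K_scaleR[of V 1 p] by simp

lemma smooth_fun_deriv: "smooth_fun f \<Longrightarrow> smooth_fun (deriv f)"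
  unfolding smooth_fun_def by (metis funpow_simps_right(2) comp_apply)

lemma smooth_fun_has_deriv:
  assumes "smooth_fun f"
  shows "(f has_real_derivative deriv f x) (at x)"
proof -
  have "f differentiable_on UNIV"
    using assms unfolding smooth_fun_def by (metis funpow_0)
  then have "f differentiable (at x)"
    by (simp add: differentiable_on_def)
  then show ?thesis
    by (meson DERIV_deriv_iff_real_differentiable)
qed

locale star_shaped_levels =
  fixes V :: "real \<Rightarrow> real" and J :: "real set"
  assumes smooth: "smooth_fun V"
    and open_J: "open J" and interval_J: "is_interval J"
    and closed: "\<And>a. a \<in> J \<Longrightarrow> closed_simple_curve (level_set V a)"
    and star: "\<And>a. a \<in> J \<Longrightarrow> star_shaped_curve (level_set V a)"
    and slope: "\<And>z w. K V (z, w) \<in> J \<Longrightarrow> deriv V (z\<^sup>2) > 0"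
begin

abbreviation root :: "real \<times> real \<Rightarrow> real \<Rightarrow> real" where
  "root p \<equiv> nonneg_root (ray_energy V p)"

lemma convex_J: "convex J"
  using interval_J by (simp add: is_interval_convex_1)

lemma ray_energy_levels:
  assumes p: "p \<noteq> 0"
  shows "increasing_levels (ray_energy V p)
           (\<lambda>s. (snd p)\<^sup>2 / 2 + deriv V (s * (fst p)\<^sup>2) * (fst p)\<^sup>2) J"
proof
  show "is_interval J"
    by (rule interval_J)
  show "(ray_energy V p has_real_derivative (snd p)\<^sup>2 / 2 + deriv V (s * (fst p)\<^sup>2) * (fst p)\<^sup>2) (at s)" for s
    unfolding ray_energy_def
    by (auto intro!: derivative_eq_intros DERIV_chain2[OF smooth_fun_has_deriv[OF smooth]])
  show "\<exists>!s. 0 \<le> s \<and> ray_energy V p s = a" if a: "a \<in> J" for a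
  proof -
    obtain q where q: "ray p \<inter> level_set V a = {q}"
      using star[OF a] p unfolding star_shaped_curve_def by metis
    then obtain t where t: "0 \<le> t" "q = t *\<^sub>R p" "K V q = a"
      unfolding ray_def level_set_def by blast
    show ?thesis
    proof (rule ex1I[of _ "t\<^sup>2"])
      show "0 \<le> t\<^sup>2 \<and> ray_energy V p (t\<^sup>2) = a"
        using t by (simp add: K_scaleR)
      fix s assume s: "0 \<le> s \<and> ray_energy V p s = a"
      then have "sqrt s *\<^sub>R p \<in> ray p \<inter> level_set V a"
        unfolding ray_def level_set_def by (auto simp: K_scaleR)
      then have "sqrt s *\<^sub>R p = t *\<^sub>R p"
        using q t by simp
      then have "sqrt s = t"
        using p by simp
      then show "s = t\<^sup>2"
        using s by auto
    qed
  qed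
  show "0 < (snd p)\<^sup>2 / 2 + deriv V (s * (fst p)\<^sup>2) * (fst p)\<^sup>2"
    if s: "0 \<le> s" "ray_energy V p s \<in> J" for s
  proof -
    have "K V (sqrt s * fst p, sqrt s * snd p) \<in> J"
      using K_sqrt_scaleR[OF s(1), of V p] s(2) by (cases p) simp
    from slope[OF this] have "0 < deriv V (s * (fst p)\<^sup>2)"
      using s by (simp add: power_mult_distrib)
    moreover have "fst p \<noteq> 0 \<or> snd p \<noteq> 0"
      using p by (auto simp: prod_eq_iff)
    ultimately show ?thesis
      by (auto simp: add_nonneg_pos add_pos_nonneg)
  qed
qed

text \<open>A root at \<open>0\<close> would put the origin on the curve; the origin lies on every ray, contradicting
  that the ray meets the curve away from it.\<close>

lemma root_pos:
  assumes p: "p \<noteq> 0" and a: "a \<in> J"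
  shows "0 < root p a"
proof -
  interpret increasing_levels "ray_energy V p" "\<lambda>s. (snd p)\<^sup>2 / 2 + deriv V (s * (fst p)\<^sup>2) * (fst p)\<^sup>2" J
    by (rule ray_energy_levels[OF p])
  obtain q where q: "q \<noteq> 0" "ray p \<inter> level_set V a = {q}"
    using star[OF a] p unfolding star_shaped_curve_def by metis
  have "0 \<in> ray p"
    unfolding ray_def by force
  then have "K V 0 \<noteq> a"
    using q unfolding level_set_def by auto
  then have "root p a \<noteq> 0"
    using K_scaleR[of V 0 p] h_root[OF a] by auto
  then show ?thesis
    using root_nonneg[OF a] by simp
qed

lemma less_root_iff:
  assumes "p \<noteq> 0" "a \<in> J" "0 \<le> s"
  shows "ray_energy V p s < a \<longleftrightarrow> s < root p a"
  using increasing_levels.less_iff[OF ray_energy_levels] assms by blast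

lemma K_0_less: "a \<in> J \<Longrightarrow> K V 0 < a"
  using less_root_iff[of "(0, 1)" a 0] root_pos[of "(0, 1)" a] K_scaleR[of V 0 "(0, 1)"]
  by (simp add: zero_prod_def)

lemma continuous_K: "continuous_on A (K V)"
proof -
  have "continuous_on B V" for B
    using smooth_fun_has_deriv[OF smooth] by (meson DERIV_continuous_on DERIV_subset subset_UNIV)
  then have "continuous_on A (\<lambda>p. V ((fst p)\<^sup>2))"
    by (rule continuous_on_compose2[where t = UNIV]) (auto intro!: continuous_intros)
  then show ?thesis
    unfolding K_def case_prod_unfold by (intro continuous_intros) auto
qed

lemma open_K_less: "open {p. K V p < a}" and open_K_greater: "open {p. a < K V p}"
  using continuous_K[of UNIV] by (auto intro!: open_Collect_less)

text \<open>A point of lower energy lies nearer to the origin than the point of the compact curve on its ray.\<close>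

lemma bounded_sublevel:
  assumes a: "a \<in> J"
  shows "bounded {p. K V p < a}"
proof -
  have "compact (level_set V a)"
    using closed[OF a] compact_simple_path_image unfolding closed_simple_curve_def by metis
  then obtain B where B: "0 < B" "\<And>q. q \<in> level_set V a \<Longrightarrow> norm q \<le> B"
    by (meson bounded_pos compact_imp_bounded)
  have "norm p \<le> B" if p: "K V p < a" for p
  proof (cases "p = 0")
    case False
    interpret increasing_levels "ray_energy V p" "\<lambda>s. (snd p)\<^sup>2 / 2 + deriv V (s * (fst p)\<^sup>2) * (fst p)\<^sup>2" J
      by (rule ray_energy_levels[OF False])
    have "1 < root p a"
      using p less_root_iff[OF False a, of 1] by (simp add: K_eq_ray_energy)
    then have "1 * norm p \<le> sqrt (root p a) * norm p"
      by (intro mult_right_mono) auto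
    also have "sqrt (root p a) *\<^sub>R p \<in> level_set V a"
      using root[OF a] by (simp add: level_set_def K_scaleR)
    then have "sqrt (root p a) * norm p \<le> B"
      using B(2) root_nonneg[OF a] by fastforce
    finally show ?thesis by simp
  qed (use B in simp)
  then show ?thesis
    unfolding bounded_iff by blast
qed

text \<open>The complement of the curve splits into the open sets \<open>K < a\<close> and \<open>K > a\<close>. A connected set
  cannot meet both, and the first is bounded; a point of the second can escape along its ray.\<close>

lemma inside_level_set:
  assumes a: "a \<in> J"
  shows "inside (level_set V a) = {p. K V p < a}"
proof (intro set_eqI iffI)
  let ?C = "level_set V a"
  fix p
  show "p \<in> inside ?C" if "p \<in> {p. K V p < a}"
  proof -
    let ?S = "connected_component_set (- ?C) p"
    have p: "K V p < a" "p \<in> - ?C"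
      using that by (auto simp: level_set_def)
    have sub: "?S \<subseteq> {p. K V p < a} \<union> {p. a < K V p}"
      using connected_component_subset[of "- ?C" p] unfolding level_set_def by auto
    have "{p. K V p < a} \<inter> {p. a < K V p} \<inter> ?S = {}"
      by auto
    then have "{p. K V p < a} \<inter> ?S = {} \<or> {p. a < K V p} \<inter> ?S = {}"
      by (rule connectedD[OF connected_connected_component open_K_less open_K_greater _ sub])
    moreover have "p \<in> ?S"
      using p by simp
    ultimately have "?S \<subseteq> {p. K V p < a}"
      using p sub by blast
    then have "bounded ?S"
      using bounded_sublevel[OF a] bounded_subset by blast
    then show ?thesis
      using p unfolding inside_def by auto
  qed
  show "p \<in> {p. K V p < a}" if "p \<in> inside ?C"
  proof (rule ccontr)
    assume "p \<notin> {p. K V p < a}"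
    moreover have pC: "p \<notin> ?C" and bdd: "bounded (connected_component_set (- ?C) p)"
      using that unfolding inside_def by auto
    ultimately have p: "a < K V p"
      by (auto simp: level_set_def)
    have p0: "p \<noteq> 0"
      using p K_0_less[OF a] by auto
    interpret increasing_levels "ray_energy V p" "\<lambda>s. (snd p)\<^sup>2 / 2 + deriv V (s * (fst p)\<^sup>2) * (fst p)\<^sup>2" J
      by (rule ray_energy_levels[OF p0])
    have r: "root p a < 1"
      using less_root_iff[OF p0 a, of 1] root_unique[OF a, of 1] h_root[OF a] p
      by (metis K_eq_ray_energy linorder_neqE_linordered_idom order_less_asym order_less_irrefl zero_le_one)
    let ?R = "(\<lambda>t. t *\<^sub>R p) ` {1..}"
    have "t *\<^sub>R p \<notin> ?C" if t: "1 \<le> t" for t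
    proof -
      have "root p a < t\<^sup>2"
        using r one_le_power[OF t, of 2] by simp
      then show ?thesis
        using above_root[OF a, of "t\<^sup>2"] by (simp add: level_set_def K_scaleR)
    qed
    then have "?R \<subseteq> - ?C"
      by auto
    moreover have "connected ?R"
      by (intro connected_continuous_image continuous_intros) auto
    moreover have "p \<in> ?R"
      by (rule image_eqI[of _ _ 1]) auto
    ultimately have "?R \<subseteq> connected_component_set (- ?C) p"
      by (intro connected_component_maximal) auto
    then have "bounded ?R"
      using bdd bounded_subset by blast
    then obtain B where B: "0 < B" "\<And>t. 1 \<le> t \<Longrightarrow> norm (t *\<^sub>R p) \<le> B"
      unfolding bounded_pos by auto
    have "norm p + B = (1 + B / norm p) * norm p"
      using p0 by (simp add: distrib_right)
    also have "\<dots> = norm ((1 + B / norm p) *\<^sub>R p)"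
      using B(1) by (simp add: abs_of_nonneg)
    also have "\<dots> \<le> B"
      using B(1) by (intro B(2)) auto
    finally show False
      using p0 by simp
  qed
qed

lemma emeasure_sublevel:
  assumes a: "a \<in> J"
  shows "emeasure lborel {p. K V p < a} = (\<integral>\<^sup>+\<tau>. ennreal (root (1, \<tau>) a) \<partial>lborel)"
proof -
  have "(\<integral>\<^sup>+x. ennreal \<bar>x\<bar> * indicator {p. K V p < a} (x, \<tau> * x) \<partial>lborel) = ennreal (root (1, \<tau>) a)"
    for \<tau>
  proof -
    have ne: "(1, \<tau>) \<noteq> (0 :: real \<times> real)"
      by (simp add: zero_prod_def)
    have "K V (x, \<tau> * x) < a \<longleftrightarrow> x\<^sup>2 < root (1, \<tau>) a" for x
      using less_root_iff[OF ne a, of "x\<^sup>2"] K_scaleR[of V x "(1, \<tau>)"] by (simp add: mult.commute)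
    then have "(\<integral>\<^sup>+x. ennreal \<bar>x\<bar> * indicator {p. K V p < a} (x, \<tau> * x) \<partial>lborel)
        = (\<integral>\<^sup>+x. ennreal \<bar>x\<bar> * indicator {x. x\<^sup>2 < root (1, \<tau>) a} x \<partial>lborel)"
      by (simp add: indicator_def)
    also have "\<dots> = ennreal (root (1, \<tau>) a)"
      using root_pos[OF ne a] by (intro nn_integral_abs_square_less) simp
    finally show ?thesis .
  qed
  then show ?thesis
    using emeasure_slope_coordinates[of "{p. K V p < a}"] open_K_less by simp
qed

lemma measurable_root:
  assumes a: "a \<in> J"
  shows "(\<lambda>\<tau>. root (1, \<tau>) a) \<in> borel_measurable borel"
proof (rule borel_measurableI_greater)
  fix s
  show "{\<tau> \<in> space borel. s < root (1, \<tau>) a} \<in> sets borel"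
  proof (cases "0 \<le> s")
    case True
    have "{\<tau>. s < root (1, \<tau>) a} = {\<tau>. ray_energy V (1, \<tau>) s < a}"
      using less_root_iff[OF _ a True] by (simp add: zero_prod_def)
    also have "open \<dots>"
      unfolding ray_energy_def by (intro open_Collect_less continuous_intros) auto
    finally show ?thesis by simp
  next
    case False
    then have "{\<tau>. s < root (1, \<tau>) a} = UNIV"
      using root_pos[OF _ a] by (auto simp: zero_prod_def intro: less_trans[of s 0])
    then show ?thesis by simp
  qed
qed

lemma finite_sublevel: "a \<in> J \<Longrightarrow> emeasure lborel {p. K V p < a} < \<infinity>"
  using emeasure_bounded_finite bounded_sublevel by blast

lemma integrable_root:
  assumes a: "a \<in> J"
  shows "integrable lborel (\<lambda>\<tau>. root (1, \<tau>) a)"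
proof (rule integrableI_nonneg)
  show "AE \<tau> in lborel. 0 \<le> root (1, \<tau>) a"
    using root_pos[OF _ a] by (auto simp: zero_prod_def less_imp_le)
  show "(\<integral>\<^sup>+\<tau>. ennreal (root (1, \<tau>) a) \<partial>lborel) < \<infinity>"
    using emeasure_sublevel[OF a] finite_sublevel[OF a] by simp
qed (use measurable_root[OF a] in simp)

lemma action_eq_integral:
  assumes a: "a \<in> J"
  shows "action V a = (\<integral>\<tau>. root (1, \<tau>) a \<partial>lborel) / (2 * pi)"
proof -
  have "(\<integral>\<tau>. root (1, \<tau>) a \<partial>lborel) = enn2real (\<integral>\<^sup>+\<tau>. ennreal (root (1, \<tau>) a) \<partial>lborel)"
    using root_pos[OF _ a] measurable_root[OF a]
    by (intro integral_eq_nn_integral) (auto simp: zero_prod_def less_imp_le)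
  then show ?thesis
    unfolding action_def measure_def inside_level_set[OF a] emeasure_sublevel[OF a] by simp
qed

text \<open>Two sublevel sets differ by at least the energies strictly in between, a nonempty open set.\<close>

lemma strict_mono_action: "strict_mono_on J (action V)"
proof (rule strict_mono_onI)
  fix a b
  assume ab: "a \<in> J" "b \<in> J" "a < b"
  let ?A = "{p. K V p < a}" and ?B = "{p. K V p < b}" and ?D = "{p. a < K V p} \<inter> {p. K V p < b}"
  let ?c = "(a + b) / 2"
  have c: "?c \<in> J"
    using ab by (intro interval_J[unfolded is_interval_1, rule_format, OF ab(1,2)]) (auto simp: field_simps)
  obtain q where "ray (0, 1) \<inter> level_set V ?c = {q}"
    using star[OF c] unfolding star_shaped_curve_def by (metis zero_prod_def prod.inject zero_neq_one)
  then have "K V q = ?c"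
    unfolding level_set_def by blast
  then have "q \<in> ?D"
    using ab by simp
  then have "?D \<noteq> {}"
    by blast
  moreover have "open ?D"
    using open_K_less open_K_greater by blast
  ultimately have "\<not> negligible ?D"
    using open_not_negligible by blast
  then have "emeasure lborel ?D \<noteq> 0"
    using \<open>open ?D\<close> by (auto simp: negligible_iff_null_sets null_sets_def)
  moreover have "emeasure lborel ?D \<noteq> \<infinity>"
    using finite_sublevel[OF ab(2)] emeasure_mono[of ?D ?B lborel] open_K_less by (auto simp: top_unique)
  ultimately have D: "0 < measure lborel ?D"
    unfolding measure_def by (simp add: enn2real_positive_iff top.not_eq_extremum zero_less_iff_neq_zero)
  have fm: "?A \<in> fmeasurable lborel" "?B \<in> fmeasurable lborel" "?D \<in> fmeasurable lborel"
    using ab finite_sublevel open_K_less \<open>open ?D\<close> \<open>emeasure lborel ?D \<noteq> \<infinity>\<close>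
    by (auto intro!: fmeasurableI simp: top.not_eq_extremum)
  have "?D - ?A = ?D"
    by auto
  then have "measure lborel ?A + measure lborel ?D = measure lborel (?A \<union> ?D)"
    using measure_Un2[OF fm(1,3)] by simp
  also have "\<dots> \<le> measure lborel ?B"
    using ab fm fmeasurableD[OF fmeasurable.Un[OF fm(1,3)]] by (intro measure_mono_fmeasurable) auto
  finally have "measure lborel ?A < measure lborel ?B"
    using D by simp
  then show "action V a < action V b"
    unfolding action_def inside_level_set[OF ab(1)] inside_level_set[OF ab(2)]
    by (simp add: divide_strict_right_mono)
qed

lemma ray_energy_deriv2:
  "((\<lambda>s. (snd p)\<^sup>2 / 2 + deriv V (s * (fst p)\<^sup>2) * (fst p)\<^sup>2) has_real_derivative
     deriv (deriv V) (s * (fst p)\<^sup>2) * (fst p)\<^sup>2 * (fst p)\<^sup>2) (at s)"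
  by (auto intro!: derivative_eq_intros DERIV_chain2[OF smooth_fun_has_deriv[OF smooth_fun_deriv[OF smooth]]])

lemma on_level:
  assumes "0 \<le> s" "ray_energy V (1, \<tau>) s \<in> J"
  shows "K V (sqrt s, sqrt s * \<tau>) \<in> J"
  using K_sqrt_scaleR[OF assms(1), of V "(1, \<tau>)"] assms by simp

lemma convex_action:
  assumes neg: "\<And>z w. K V (z, w) \<in> J \<Longrightarrow> deriv (deriv V) (z\<^sup>2) \<le> 0"
  shows "convex_on J (action V)"
  unfolding convex_on_def
proof (intro conjI ballI allI impI)
  show "convex J"
    by (rule convex_J)
  have neg_root: "deriv (deriv V) s \<le> 0" if "0 \<le> s" "ray_energy V (1, \<tau>) s \<in> J" for s \<tau>
    using neg[OF on_level[OF that]] that by simp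
  fix a b u v :: real
  assume ab: "a \<in> J" "b \<in> J" and uv: "0 \<le> u" "0 \<le> v" "u + v = 1"
  let ?c = "u *\<^sub>R a + v *\<^sub>R b"
  have c: "?c \<in> J"
    using convex_J ab uv by (simp add: convex_def)
  have "root (1, \<tau>) ?c \<le> u * root (1, \<tau>) a + v * root (1, \<tau>) b" for \<tau>
  proof -
    have "convex_on J (root (1, \<tau>))"
      using neg_root
      by (intro increasing_levels.root_convex[OF ray_energy_levels ray_energy_deriv2])
        (auto simp: zero_prod_def)
    then show ?thesis
      using ab uv unfolding convex_on_def by blast
  qed
  then have "(\<integral>\<tau>. root (1, \<tau>) ?c \<partial>lborel) \<le> (\<integral>\<tau>. u * root (1, \<tau>) a + v * root (1, \<tau>) b \<partial>lborel)"
    using integrable_root[OF c] integrable_root[OF ab(1)] integrable_root[OF ab(2)]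
    by (intro integral_mono) auto
  also have "\<dots> = u * (\<integral>\<tau>. root (1, \<tau>) a \<partial>lborel) + v * (\<integral>\<tau>. root (1, \<tau>) b \<partial>lborel)"
    using integrable_root[OF ab(1)] integrable_root[OF ab(2)] by simp
  finally show "action V ?c \<le> u * action V a + v * action V b"
    unfolding action_eq_integral[OF c] action_eq_integral[OF ab(1)] action_eq_integral[OF ab(2)]
    by (simp add: divide_right_mono flip: add_divide_distrib)
qed

lemma concave_action:
  assumes pos: "\<And>z w. K V (z, w) \<in> J \<Longrightarrow> deriv (deriv V) (z\<^sup>2) \<ge> 0"
  shows "concave_on J (action V)"
  unfolding concave_on_iff
proof (intro conjI ballI allI impI)
  show "convex J"
    by (rule convex_J)
  have pos_root: "0 \<le> deriv (deriv V) s" if "0 \<le> s" "ray_energy V (1, \<tau>) s \<in> J" for s \<tau>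
    using pos[OF on_level[OF that]] that by simp
  fix a b u v :: real
  assume ab: "a \<in> J" "b \<in> J" and uv: "0 \<le> u" "0 \<le> v" "u + v = 1"
  let ?c = "u *\<^sub>R a + v *\<^sub>R b"
  have c: "?c \<in> J"
    using convex_J ab uv by (simp add: convex_def)
  have "u * root (1, \<tau>) a + v * root (1, \<tau>) b \<le> root (1, \<tau>) ?c" for \<tau>
  proof -
    have "concave_on J (root (1, \<tau>))"
      using pos_root
      by (intro increasing_levels.root_concave[OF ray_energy_levels ray_energy_deriv2])
        (auto simp: zero_prod_def)
    then show ?thesis
      using ab uv unfolding concave_on_iff by blast
  qed
  then have "(\<integral>\<tau>. u * root (1, \<tau>) a + v * root (1, \<tau>) b \<partial>lborel) \<le> (\<integral>\<tau>. root (1, \<tau>) ?c \<partial>lborel)"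
    using integrable_root[OF c] integrable_root[OF ab(1)] integrable_root[OF ab(2)]
    by (intro integral_mono) auto
  moreover have "(\<integral>\<tau>. u * root (1, \<tau>) a + v * root (1, \<tau>) b \<partial>lborel)
      = u * (\<integral>\<tau>. root (1, \<tau>) a \<partial>lborel) + v * (\<integral>\<tau>. root (1, \<tau>) b \<partial>lborel)"
    using integrable_root[OF ab(1)] integrable_root[OF ab(2)] by simp
  ultimately show "u * action V a + v * action V b \<le> action V ?c"
    unfolding action_eq_integral[OF c] action_eq_integral[OF ab(1)] action_eq_integral[OF ab(2)]
    by (simp add: divide_right_mono flip: add_divide_distrib)
qed

end

section \<open>One action as a function of the other\<close>

lemma convex_image_of_continuous:
  fixes f :: "real \<Rightarrow> real"
  assumes "convex J" "continuous_on J f"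
  shows "convex (f ` J)"
  using assms by (metis connected_continuous_image convex_connected is_interval_connected_1 is_interval_convex_1)

lemma convex_comp_reflect_inverse:
  fixes f g :: "real \<Rightarrow> real"
  assumes J: "open J" "convex_on J f" "strict_mono_on J f"
    and g: "convex_on ((-) m ` J) g" "strict_mono_on ((-) m ` J) g"
  shows "convex_on (f ` J) (\<lambda>x. g (m - inv_into J f x))"
  unfolding convex_on_def
proof (intro conjI ballI allI impI)
  have cJ: "convex J"
    using J(2) by (simp add: convex_on_def)
  then show "convex (f ` J)"
    using convex_on_continuous[OF J(1,2)] by (rule convex_image_of_continuous)
  note inj = strict_mono_on_imp_inj_on[OF J(3)]
  fix x y u v :: real
  assume xy: "x \<in> f ` J" "y \<in> f ` J" and uv: "0 \<le> u" "0 \<le> v" "u + v = 1"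
  obtain a b where ab: "a \<in> J" "x = f a" "b \<in> J" "y = f b"
    using xy by blast
  obtain c where c: "c \<in> J" "u *\<^sub>R x + v *\<^sub>R y = f c"
    using \<open>convex (f ` J)\<close> xy uv unfolding convex_def by blast
  have d: "u *\<^sub>R a + v *\<^sub>R b \<in> J"
    using cJ ab uv by (simp add: convex_def)
  have "f (u *\<^sub>R a + v *\<^sub>R b) \<le> f c"
    using J(2) ab uv c(2)[symmetric] unfolding convex_on_def by simp
  then have "u *\<^sub>R a + v *\<^sub>R b \<le> c"
    using strict_mono_on_less_eq[OF J(3)] d c by blast
  then have "g (m - c) \<le> g (m - (u *\<^sub>R a + v *\<^sub>R b))"
    using strict_mono_on_less_eq[OF g(2) imageI[OF c(1)] imageI[OF d]] by simp
  also have "m - (u *\<^sub>R a + v *\<^sub>R b) = u *\<^sub>R (m - a) + v *\<^sub>R (m - b)"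
    using uv(3) by (simp add: algebra_simps flip: distrib_left)
  also have "g \<dots> \<le> u * g (m - a) + v * g (m - b)"
    using g(1) ab uv unfolding convex_on_def by blast
  finally show "g (m - inv_into J f (u *\<^sub>R x + v *\<^sub>R y))
      \<le> u * g (m - inv_into J f x) + v * g (m - inv_into J f y)"
    unfolding c(2) ab(2,4) using inj ab c by (simp add: inv_into_f_f)
qed

lemma concave_comp_reflect_inverse:
  fixes f g :: "real \<Rightarrow> real"
  assumes J: "open J" "concave_on J f" "strict_mono_on J f"
    and g: "concave_on ((-) m ` J) g" "strict_mono_on ((-) m ` J) g"
  shows "concave_on (f ` J) (\<lambda>x. g (m - inv_into J f x))"
  unfolding concave_on_iff
proof (intro conjI ballI allI impI)
  have cJ: "convex J"
    using J(2) by (simp add: concave_on_iff)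
  have "continuous_on J (\<lambda>x. - (- f x))"
    using convex_on_continuous[OF J(1) J(2)[unfolded concave_on_def]] by (rule continuous_on_minus)
  then show "convex (f ` J)"
    using cJ by (simp add: convex_image_of_continuous)
  note inj = strict_mono_on_imp_inj_on[OF J(3)]
  fix x y u v :: real
  assume xy: "x \<in> f ` J" "y \<in> f ` J" and uv: "0 \<le> u" "0 \<le> v" "u + v = 1"
  obtain a b where ab: "a \<in> J" "x = f a" "b \<in> J" "y = f b"
    using xy by blast
  obtain c where c: "c \<in> J" "u *\<^sub>R x + v *\<^sub>R y = f c"
    using \<open>convex (f ` J)\<close> xy uv unfolding convex_def by blast
  have d: "u *\<^sub>R a + v *\<^sub>R b \<in> J"
    using cJ ab uv by (simp add: convex_def)
  have "f c \<le> f (u *\<^sub>R a + v *\<^sub>R b)"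
    using J(2) ab uv c(2)[symmetric] unfolding concave_on_iff by simp
  then have "c \<le> u *\<^sub>R a + v *\<^sub>R b"
    using strict_mono_on_less_eq[OF J(3)] d c by blast
  then have "g (m - (u *\<^sub>R a + v *\<^sub>R b)) \<le> g (m - c)"
    using strict_mono_on_less_eq[OF g(2) imageI[OF d] imageI[OF c(1)]] by simp
  moreover have "m - (u *\<^sub>R a + v *\<^sub>R b) = u *\<^sub>R (m - a) + v *\<^sub>R (m - b)"
    using uv(3) by (simp add: algebra_simps flip: distrib_left)
  moreover have "u * g (m - a) + v * g (m - b) \<le> g (u *\<^sub>R (m - a) + v *\<^sub>R (m - b))"
    using g(1) ab uv unfolding concave_on_iff by blast
  ultimately show "u * g (m - inv_into J f x) + v * g (m - inv_into J f y)
      \<le> g (m - inv_into J f (u *\<^sub>R x + v *\<^sub>R y))"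
    unfolding c(2) ab(2,4) using inj ab c by (simp add: inv_into_f_f)
qed

theorem mainTheorem7:
  fixes V1 V2 :: "real \<Rightarrow> real" and m :: real and J :: "real set"
  assumes "smooth_fun V1" and "smooth_fun V2"
    and "open J" and "is_interval J"
    and "\<And>a. a \<in> J \<Longrightarrow>
           closed_simple_curve (level_set V1 a) \<and> star_shaped_curve (level_set V1 a)"
    and "\<And>a. a \<in> J \<Longrightarrow>
           closed_simple_curve (level_set V2 (m - a)) \<and> star_shaped_curve (level_set V2 (m - a))"
  shows "((\<forall>a\<in>J. \<forall>(z, w)\<in>level_set V1 a. deriv V1 (z\<^sup>2) > 0 \<and> deriv (deriv V1) (z\<^sup>2) < 0) \<and>
          (\<forall>a\<in>J. \<forall>(z, w)\<in>level_set V2 (m - a). deriv V2 (z\<^sup>2) > 0 \<and> deriv (deriv V2) (z\<^sup>2) < 0)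
          \<longrightarrow> (\<exists>\<phi>. (\<forall>a\<in>J. \<phi> (action V1 a) = action V2 (m - a)) \<and> convex_on (action V1 ` J) \<phi>))
       \<and> ((\<forall>a\<in>J. \<forall>(z, w)\<in>level_set V1 a. deriv V1 (z\<^sup>2) > 0 \<and> deriv (deriv V1) (z\<^sup>2) > 0) \<and>
          (\<forall>a\<in>J. \<forall>(z, w)\<in>level_set V2 (m - a). deriv V2 (z\<^sup>2) > 0 \<and> deriv (deriv V2) (z\<^sup>2) > 0)
          \<longrightarrow> (\<exists>\<phi>. (\<forall>a\<in>J. \<phi> (action V1 a) = action V2 (m - a)) \<and> concave_on (action V1 ` J) \<phi>))"
proof (intro conjI impI)
  let ?\<phi> = "\<lambda>x. action V2 (m - inv_into J (action V1) x)"
  let ?L = "(-) m ` J"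
  have L: "open ?L" "is_interval ?L"
    using assms(3,4) by (auto simp: open_neg_translation is_interval_minus_translation)
  have phi: "\<forall>a\<in>J. ?\<phi> (action V1 a) = action V2 (m - a)" if "strict_mono_on J (action V1)"
    using strict_mono_on_imp_inj_on[OF that] by simp
  {
    assume A: "(\<forall>a\<in>J. \<forall>(z, w)\<in>level_set V1 a. deriv V1 (z\<^sup>2) > 0 \<and> deriv (deriv V1) (z\<^sup>2) < 0) \<and>
      (\<forall>a\<in>J. \<forall>(z, w)\<in>level_set V2 (m - a). deriv V2 (z\<^sup>2) > 0 \<and> deriv (deriv V2) (z\<^sup>2) < 0)"
    have A1: "deriv V1 (z\<^sup>2) > 0 \<and> deriv (deriv V1) (z\<^sup>2) < 0" if "K V1 (z, w) \<in> J" for z w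
      using A that unfolding level_set_def by blast
    have A2: "deriv V2 (z\<^sup>2) > 0 \<and> deriv (deriv V2) (z\<^sup>2) < 0" if "K V2 (z, w) \<in> ?L" for z w
      using A that unfolding level_set_def by blast
    interpret S1: star_shaped_levels V1 J
      by unfold_locales (use assms(1,3,4,5) A1 in blast)+
    interpret S2: star_shaped_levels V2 ?L
      by unfold_locales (use assms(2,6) L A2 in blast)+
    have "convex_on J (action V1)" "convex_on ?L (action V2)"
      using A1 A2 less_imp_le by (blast intro: S1.convex_action S2.convex_action)+
    then have "convex_on (action V1 ` J) ?\<phi>"
      using convex_comp_reflect_inverse S1.strict_mono_action S2.strict_mono_action assms(3) by blast
    then show "\<exists>\<phi>. (\<forall>a\<in>J. \<phi> (action V1 a) = action V2 (m - a)) \<and> convex_on (action V1 ` J) \<phi>"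
      using phi[OF S1.strict_mono_action] by (intro exI[of _ ?\<phi>]) blast
  next
    assume A: "(\<forall>a\<in>J. \<forall>(z, w)\<in>level_set V1 a. deriv V1 (z\<^sup>2) > 0 \<and> deriv (deriv V1) (z\<^sup>2) > 0) \<and>
      (\<forall>a\<in>J. \<forall>(z, w)\<in>level_set V2 (m - a). deriv V2 (z\<^sup>2) > 0 \<and> deriv (deriv V2) (z\<^sup>2) > 0)"
    have A1: "deriv V1 (z\<^sup>2) > 0 \<and> deriv (deriv V1) (z\<^sup>2) > 0" if "K V1 (z, w) \<in> J" for z w
      using A that unfolding level_set_def by blast
    have A2: "deriv V2 (z\<^sup>2) > 0 \<and> deriv (deriv V2) (z\<^sup>2) > 0" if "K V2 (z, w) \<in> ?L" for z w
      using A that unfolding level_set_def by blast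
    interpret S1: star_shaped_levels V1 J
      by unfold_locales (use assms(1,3,4,5) A1 in blast)+
    interpret S2: star_shaped_levels V2 ?L
      by unfold_locales (use assms(2,6) L A2 in blast)+
    have "concave_on J (action V1)" "concave_on ?L (action V2)"
      using A1 A2 less_imp_le by (blast intro: S1.concave_action S2.concave_action)+
    then have "concave_on (action V1 ` J) ?\<phi>"
      using concave_comp_reflect_inverse S1.strict_mono_action S2.strict_mono_action assms(3) by blast
    then show "\<exists>\<phi>. (\<forall>a\<in>J. \<phi> (action V1 a) = action V2 (m - a)) \<and> concave_on (action V1 ` J) \<phi>"
      using phi[OF S1.strict_mono_action] by (intro exI[of _ ?\<phi>]) blast
  }
qed

end
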